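(* Let $\Omega\subset\mathbb{R}^n$ be a bounded open set. Let $F(x,s,p,M)$ be a continuous function on $\Omega\times\mathbb{R}\times\mathbb{R}^n\times\mathcal{S}^{n\times n}$ whose derivatives in $(s,p,M)$ are continuous. Assume that $F$ is (possibly degenerate) elliptic, i.e. the matrix $\big(\frac{\partial F}{\partial M_{ij}}\big)$ is positive semidefinite for all values of the arguments, and that there is a unit vector $\xi\in\mathbb{R}^n$ such that $$\frac{\partial F}{\partial M_{ij}}\xi_i\xi_j>0\quad\text{for all values of the arguments of }F.$$ Let $u\in LSC(\overline\Omega)$ and $v\in C^2(\Omega)\cap C(\overline\Omega)$ satisfy $$F(x,u,\nabla u,\nabla^2u)\le F(x,v,\nabla v,\nabla^2v)\quad\text{in }\Omega\text{ in the viscosity sense},$$ $$u\ge v\ \text{ on }\partial\Omega,\qquad\inf_\Omega u>-\infty.$$ Then $u\ge v$ in $\Omega$ provided $$F_s(x,s,p,M)\le0\quad\text{for all }(x,s,p,M).$$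
   Context: $\mathcal{S}^{n\times n}$ is the set of real symmetric $n\times n$ matrices; $LSC(\overline\Omega)$ is the set of lower-semicontinuous functions on $\overline\Omega$; repeated indices are summed; $F_s=\partial F/\partial s$. Viscosity sense: whenever $x_0\in\Omega$ and $\varphi$ is $C^2$ near $x_0$ with $\varphi\le u$ near $x_0$ and $\varphi(x_0)=u(x_0)$, one has $F(x_0,\varphi(x_0),\nabla\varphi(x_0),\nabla^2\varphi(x_0))\le F(x_0,v(x_0),\nabla v(x_0),\nabla^2v(x_0))$. *)

theory Defs
  imports "HOL-Analysis.Analysis"
begin

definition sym_matrices :: "(real^'n^'n) set"
  where "sym_matrices = {M. transpose M = M}"

definition pos_semidef :: "real^'n^'n \<Rightarrow> bool"
  where "pos_semidef A \<longleftrightarrow> transpose A = A \<and> (\<forall>y. 0 \<le> y \<bullet> (A *v y))"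

definition lsc_on :: "'a::topological_space set \<Rightarrow> ('a \<Rightarrow> real) \<Rightarrow> bool"
  where "lsc_on S u \<longleftrightarrow> (\<forall>x\<in>S. \<forall>a < u x. \<forall>\<^sub>F y in at x within S. a < u y)"

text \<open>Only meaningful where the derivatives in question exist, which \<open>C2_on\<close> guarantees.
  The \<open>(i, j)\<close> entry of the Hessian is the \<open>j\<close>-th partial derivative of the \<open>i\<close>-th
  partial derivative.\<close>

definition grad :: "(real^'n \<Rightarrow> real) \<Rightarrow> real^'n \<Rightarrow> real^'n"
  where "grad f x = (\<chi> i. frechet_derivative f (at x) (axis i 1))"

definition hessian :: "(real^'n \<Rightarrow> real) \<Rightarrow> real^'n \<Rightarrow> real^'n^'n"
  where "hessian f x = jacobian (grad f) (at x)"

text \<open>Twice continuously differentiable; intended for open \<open>U\<close> only, since the derivatives are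
  unrestricted ones.  Differentiability of \<open>grad f\<close> makes \<open>f\<close> and \<open>grad f\<close> continuous.\<close>

definition C2_on :: "(real^'n) set \<Rightarrow> (real^'n \<Rightarrow> real) \<Rightarrow> bool"
  where "C2_on U f \<longleftrightarrow>
    (\<forall>x\<in>U. f differentiable (at x)) \<and>
    (\<forall>x\<in>U. grad f differentiable (at x)) \<and>
    continuous_on U (hessian f)"

text \<open>
  \<open>F x s p M\<close> matters only for \<open>x \<in> \<Omega>\<close> and symmetric \<open>M\<close>.
  \<open>C1_in_spM \<Omega> F Fs Fp FM\<close> says that \<open>F\<close> is continuous on its domain and that \<open>Fs\<close>, \<open>Fp\<close>, \<open>FM\<close>
  are its partial derivatives in \<open>s\<close>, \<open>p\<close>, \<open>M\<close>, all jointly continuous there.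
  The derivative in \<open>M\<close> is taken within the space of symmetric matrices.  It is represented, via
  the entrywise inner product of matrices, by a symmetric matrix \<open>FM x s p M\<close>, which is thereby
  uniquely determined: its \<open>(i, j)\<close> entry is \<open>\<partial>F/\<partial>M\<^sub>i\<^sub>j\<close>, with the convention that the
  derivative in direction \<open>H\<close> is the sum of \<open>\<partial>F/\<partial>M\<^sub>i\<^sub>j * H\<^sub>i\<^sub>j\<close> over all ordered pairs \<open>(i, j)\<close>.
\<close>

definition C1_in_spM ::
  "(real^'n) set \<Rightarrow>
   (real^'n \<Rightarrow> real \<Rightarrow> real^'n \<Rightarrow> real^'n^'n \<Rightarrow> real) \<Rightarrow>
   (real^'n \<Rightarrow> real \<Rightarrow> real^'n \<Rightarrow> real^'n^'n \<Rightarrow> real) \<Rightarrow>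
   (real^'n \<Rightarrow> real \<Rightarrow> real^'n \<Rightarrow> real^'n^'n \<Rightarrow> real^'n) \<Rightarrow>
   (real^'n \<Rightarrow> real \<Rightarrow> real^'n \<Rightarrow> real^'n^'n \<Rightarrow> real^'n^'n) \<Rightarrow> bool"
  where "C1_in_spM \<Omega> F Fs Fp FM \<longleftrightarrow>
    continuous_on (\<Omega> \<times> UNIV \<times> UNIV \<times> sym_matrices) (\<lambda>(x, s, p, M). F x s p M) \<and>
    (\<forall>x\<in>\<Omega>. \<forall>s p. \<forall>M\<in>sym_matrices.
       ((\<lambda>t. F x t p M) has_real_derivative Fs x s p M) (at s) \<and>
       GDERIV (\<lambda>q. F x s q M) p :> Fp x s p M \<and>
       FM x s p M \<in> sym_matrices \<and>
       ((\<lambda>N. F x s p N) has_derivative (\<lambda>H. FM x s p M \<bullet> H)) (at M within sym_matrices)) \<and>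
    continuous_on (\<Omega> \<times> UNIV \<times> UNIV \<times> sym_matrices) (\<lambda>(x, s, p, M). Fs x s p M) \<and>
    continuous_on (\<Omega> \<times> UNIV \<times> UNIV \<times> sym_matrices) (\<lambda>(x, s, p, M). Fp x s p M) \<and>
    continuous_on (\<Omega> \<times> UNIV \<times> UNIV \<times> sym_matrices) (\<lambda>(x, s, p, M). FM x s p M)"

text \<open>\<open>F(x, u, \<nabla>u, \<nabla>\<^sup>2u) \<le> F(x, v, \<nabla>v, \<nabla>\<^sup>2v)\<close> in \<open>\<Omega>\<close> in the viscosity sense.\<close>

definition viscosity_le ::
  "(real^'n) set \<Rightarrow>
   (real^'n \<Rightarrow> real \<Rightarrow> real^'n \<Rightarrow> real^'n^'n \<Rightarrow> real) \<Rightarrow>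
   (real^'n \<Rightarrow> real) \<Rightarrow> (real^'n \<Rightarrow> real) \<Rightarrow> bool"
  where "viscosity_le \<Omega> F u v \<longleftrightarrow>
    (\<forall>x0\<in>\<Omega>. \<forall>\<phi>.
       (\<exists>U. open U \<and> x0 \<in> U \<and> C2_on U \<phi>) \<longrightarrow>
       (\<forall>\<^sub>F y in nhds x0. \<phi> y \<le> u y) \<longrightarrow>
       \<phi> x0 = u x0 \<longrightarrow>
       F x0 (\<phi> x0) (grad \<phi> x0) (hessian \<phi> x0) \<le> F x0 (v x0) (grad v x0) (hessian v x0))"

end

theory Submission
  imports Defs
begin

text \<open>
  Suppose \<open>u - v\<close> takes a negative value \<open>-m\<close>.  Since \<open>u - v\<close> is lower semicontinuous and
  nonnegative on the boundary, the set \<open>K\<close> of points of \<open>closure \<Omega>\<close> where \<open>u - v \<le> -m/2\<close> is a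
  compact subset of \<open>\<Omega>\<close>.  Perturb \<open>v\<close> to \<open>v + \<epsilon> h\<close> with the barrier \<open>h x = exp (\<alpha> (\<xi> \<bullet> x))\<close>.  For
  small \<open>\<epsilon>\<close> the difference \<open>u - (v + \<epsilon> h)\<close> attains its minimum over \<open>closure \<Omega>\<close> at a point \<open>x0\<close> of
  \<open>K\<close>, so a vertical translate of \<open>v + \<epsilon> h\<close> is a \<open>C\<^sup>2\<close> function touching \<open>u\<close> from below at \<open>x0\<close>.
  The viscosity inequality then bounds \<open>F\<close> at \<open>u x0\<close> and the derivatives of \<open>v + \<epsilon> h\<close> by \<open>F\<close> at
  \<open>v x0\<close> and the derivatives of \<open>v\<close>; as \<open>u x0 < v x0\<close> and \<open>F\<close> is nonincreasing in \<open>s\<close>, the value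
  \<open>u x0\<close> can be replaced by \<open>v x0\<close>.

  The other direction comes from the barrier.  Its gradient is \<open>\<alpha> h \<xi>\<close> and its Hessian is
  \<open>\<alpha>\<^sup>2 h\<close> times the rank one matrix with entries \<open>\<xi>\<^sub>i \<xi>\<^sub>j\<close>, so by the mean value theorem the
  perturbation increases \<open>F\<close> by at least \<open>\<epsilon> \<alpha> h (\<alpha> \<lambda> - \<Lambda>)\<close>.  Here \<open>\<lambda> > 0\<close> is a lower bound of
  \<open>\<partial>F/\<partial>M\<^sub>i\<^sub>j \<xi>\<^sub>i \<xi>\<^sub>j\<close> and \<open>\<Lambda>\<close> an upper bound of the norm of \<open>\<partial>F/\<partial>p\<close>, both over the compact set of
  arguments lying over \<open>K\<close> and within distance one of the derivatives of \<open>v\<close>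
  (\<open>uniform_bounds_near_jet\<close>).  The set \<open>K\<close> does not involve the barrier, so \<open>\<alpha>\<close> can be chosen with
  \<open>\<alpha> \<lambda> > \<Lambda>\<close> before \<open>\<epsilon>\<close> is, and the two inequalities contradict each other.

  The matrix argument of \<open>F\<close> has to be symmetric throughout, which rests on the symmetry of the
  Hessian of a \<open>C\<^sup>2\<close> function (\<open>hessian_symmetric\<close>).
\<close>

section \<open>Lower semicontinuous functions on compact sets\<close>

lemma lsc_on_openin_superlevel:
  assumes "lsc_on S u"
  shows "openin (top_of_set S) {x \<in> S. a < u x}"
proof (subst openin_subopen, intro ballI)
  fix x assume "x \<in> {x \<in> S. a < u x}"
  then have x: "x \<in> S" "a < u x" by auto
  with assms have "\<forall>\<^sub>F y in at x within S. a < u y"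
    by (auto simp: lsc_on_def)
  then obtain T where T: "open T" "x \<in> T" "\<forall>y\<in>T. y \<noteq> x \<longrightarrow> y \<in> S \<longrightarrow> a < u y"
    by (auto simp: eventually_at_topological)
  have "openin (top_of_set S) (S \<inter> T)"
    using T(1) by blast
  moreover have "x \<in> S \<inter> T" "S \<inter> T \<subseteq> {x \<in> S. a < u x}"
    using T x by auto
  ultimately show "\<exists>T. openin (top_of_set S) T \<and> x \<in> T \<and> T \<subseteq> {x \<in> S. a < u x}"
    by blast
qed

lemma lsc_on_closedin_sublevel:
  assumes "lsc_on S u"
  shows "closedin (top_of_set S) {x \<in> S. u x \<le> a}"
proof -
  have "{x \<in> S. u x \<le> a} = S - {x \<in> S. a < u x}" by auto
  then show ?thesis
    using lsc_on_openin_superlevel[OF assms, of a] by (simp add: closedin_diff)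
qed

lemma lsc_on_diff_continuous:
  assumes u: "lsc_on S u" and w: "continuous_on S w"
  shows "lsc_on S (\<lambda>x. u x - w x)"
  unfolding lsc_on_def
proof (intro ballI allI impI)
  fix x a assume x: "x \<in> S" and a: "a < u x - w x"
  define d where "d = (u x - w x - a) / 2"
  have d: "0 < d" using a by (simp add: d_def)
  have "\<forall>\<^sub>F y in at x within S. u x - d < u y"
    using u x d by (auto simp: lsc_on_def)
  moreover have "\<forall>\<^sub>F y in at x within S. w y < w x + d"
    using w x d by (intro order_tendstoD(2)[of w "w x"]) (auto simp: continuous_on)
  ultimately show "\<forall>\<^sub>F y in at x within S. a < u y - w y"
    by eventually_elim (use d in \<open>simp add: d_def field_simps\<close>)
qed

text \<open>
  If no point were a minimum, the superlevel sets \<open>{u > u y}\<close> would cover the compact set; among the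
  finitely many \<open>y\<close> of a subcover the one with the least value would be left uncovered.
\<close>

lemma lsc_on_attains_min:
  assumes u: "lsc_on S u" and S: "compact S" "S \<noteq> {}"
  obtains x where "x \<in> S" "\<And>y. y \<in> S \<Longrightarrow> u x \<le> u y"
proof -
  have "\<exists>x\<in>S. \<forall>y\<in>S. u x \<le> u y"
  proof (rule ccontr)
    assume no_min: "\<not> ?thesis"
    define V where "V y = {x \<in> S. u y < u x}" for y
    have "\<exists>D\<subseteq>V ` S. finite D \<and> S \<subseteq> \<Union>D"
    proof (rule iffD1[OF compact_eq_openin_cover S(1), rule_format], intro conjI ballI)
      show "openin (top_of_set S) W" if "W \<in> V ` S" for W
        using that lsc_on_openin_superlevel[OF u] by (auto simp: V_def)
      show "S \<subseteq> \<Union>(V ` S)"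
        using no_min by (auto simp: V_def not_le)
    qed
    then obtain Y where Y: "Y \<subseteq> S" "finite Y" "S \<subseteq> \<Union>(V ` Y)"
      by (metis finite_subset_image)
    have "Y \<noteq> {}" using Y(3) S(2) by auto
    then obtain y where y: "y \<in> Y" "\<And>z. z \<in> Y \<Longrightarrow> u y \<le> u z"
      using Y(2) by (metis arg_min_if_finite(1) arg_min_least)
    then obtain z where "z \<in> Y" "y \<in> V z"
      using Y by blast
    with y show False by (auto simp: V_def not_less[symmetric])
  qed
  then show thesis using that by blast
qed

section \<open>Gradients and Hessians\<close>

lemma has_derivative_grad:
  fixes f :: "real^'n \<Rightarrow> real"
  assumes "f differentiable (at x)"
  shows "(f has_derivative (\<lambda>h. h \<bullet> grad f x)) (at x)"
proof -
  define D where "D = frechet_derivative f (at x)"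
  have D: "(f has_derivative D) (at x)"
    using assms by (simp add: D_def frechet_derivative_works)
  then have lin: "linear D" by (simp add: has_derivative_linear)
  have "D h = h \<bullet> grad f x" for h
  proof -
    have "D h = D (\<Sum>i\<in>UNIV. (h $ i) *\<^sub>R axis i 1)"
      by (simp add: basis_expansion flip: scalar_mult_eq_scaleR)
    also have "\<dots> = (\<Sum>i\<in>UNIV. h $ i * D (axis i 1))"
      by (simp add: linear_sum[OF lin] linear_cmul[OF lin])
    also have "\<dots> = h \<bullet> grad f x"
      by (simp add: inner_vec_def grad_def D_def)
    finally show ?thesis .
  qed
  with D show ?thesis by (simp add: has_derivative_subst ext)
qed

lemma grad_eqI:
  fixes f :: "real^'n \<Rightarrow> real"
  assumes "(f has_derivative (\<lambda>h. h \<bullet> G)) (at x)"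
  shows "grad f x = G"
  using frechet_derivative_at[OF assms, symmetric]
  by (simp add: grad_def vec_eq_iff inner_axis')

lemma has_derivative_hessian:
  assumes "grad f differentiable (at x)"
  shows "(grad f has_derivative (\<lambda>h. hessian f x *v h)) (at x)"
  using assms by (simp add: hessian_def flip: jacobian_works)

lemma C2_onI:
  fixes f :: "real^'n \<Rightarrow> real"
  assumes U: "open U"
    and f: "\<And>z. z \<in> U \<Longrightarrow> (f has_derivative (\<lambda>h. h \<bullet> g z)) (at z)"
    and g: "\<And>z. z \<in> U \<Longrightarrow> (g has_derivative (\<lambda>h. A z *v h)) (at z)"
    and A: "continuous_on U A"
  shows "C2_on U f"
    and "\<And>z. z \<in> U \<Longrightarrow> grad f z = g z"
    and "\<And>z. z \<in> U \<Longrightarrow> hessian f z = A z"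
proof -
  show gr: "grad f z = g z" if "z \<in> U" for z
    using grad_eqI[OF f[OF that]] .
  have dg: "(grad f has_derivative (\<lambda>h. A z *v h)) (at z)" if "z \<in> U" for z
    using has_derivative_transform_within_open[OF g[OF that] U that] gr by simp
  show he: "hessian f z = A z" if "z \<in> U" for z
    using frechet_derivative_at[OF dg[OF that], symmetric]
    by (simp add: hessian_def jacobian_def)
  show "C2_on U f"
    unfolding C2_on_def
    using f dg A he by (auto simp: differentiable_def cong: continuous_on_cong)
qed

text \<open>
  Apply the mean value theorem to \<open>s \<mapsto> f (x + s a + b) - f (x + s a)\<close>, and once more to the
  resulting difference of gradients.  The left-hand side is symmetric in \<open>a\<close> and \<open>b\<close>, the
  right-hand side is not visibly so; this is the source of the symmetry of second derivatives.
\<close>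

lemma second_difference_mean_value:
  fixes f :: "'a::real_inner \<Rightarrow> real"
  assumes f: "\<And>z. z \<in> ball x r \<Longrightarrow> (f has_derivative (\<lambda>h. h \<bullet> g z)) (at z)"
    and g: "\<And>z. z \<in> ball x r \<Longrightarrow> (g has_derivative H z) (at z)"
    and r: "norm a + norm b < r"
  obtains z where "z \<in> ball x r" "f (x + a + b) - f (x + a) - f (x + b) + f x = a \<bullet> H z b"
proof -
  have in_ball: "x + s *\<^sub>R a + t *\<^sub>R b \<in> ball x r" if "s \<in> {0..1}" "t \<in> {0..1}" for s t
  proof -
    have "norm (s *\<^sub>R a + t *\<^sub>R b) \<le> norm (s *\<^sub>R a) + norm (t *\<^sub>R b)"
      by (rule norm_triangle_ineq)
    also have "\<dots> \<le> norm a + norm b"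
      using that by (auto intro!: add_mono mult_left_le_one_le)
    finally have "norm (s *\<^sub>R a + t *\<^sub>R b) < r"
      using r by linarith
    moreover have "dist x (x + s *\<^sub>R a + t *\<^sub>R b) = norm (s *\<^sub>R a + t *\<^sub>R b)"
      by (metis add.assoc add_diff_cancel_left' dist_commute dist_norm)
    ultimately show ?thesis by simp
  qed
  define \<psi> where "\<psi> s = f (x + s *\<^sub>R a + 1 *\<^sub>R b) - f (x + s *\<^sub>R a + 0 *\<^sub>R b)" for s
  have d1: "((\<lambda>s. f (x + s *\<^sub>R a + c *\<^sub>R b)) has_derivative
      (\<lambda>h. (h *\<^sub>R a) \<bullet> g (x + s *\<^sub>R a + c *\<^sub>R b))) (at s within {0..1})"
    if "s \<in> {0..1}" "c \<in> {0..1}" for s c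
  proof (rule has_derivative_compose[where g = f])
    show "(f has_derivative (\<lambda>h. h \<bullet> g (x + s *\<^sub>R a + c *\<^sub>R b))) (at (x + s *\<^sub>R a + c *\<^sub>R b))"
      using that by (intro f in_ball)
  qed (auto intro!: derivative_eq_intros)
  have "\<exists>s\<in>{0<..<1}. \<psi> 1 - \<psi> 0
      = (\<lambda>h. (h *\<^sub>R a) \<bullet> g (x + s *\<^sub>R a + 1 *\<^sub>R b) - (h *\<^sub>R a) \<bullet> g (x + s *\<^sub>R a + 0 *\<^sub>R b)) (1 - 0)"
    unfolding \<psi>_def
    by (intro mvt_simple has_derivative_diff d1) auto
  then obtain s where s: "s \<in> {0<..<1}"
    "\<psi> 1 - \<psi> 0 = a \<bullet> (g (x + s *\<^sub>R a + 1 *\<^sub>R b) - g (x + s *\<^sub>R a + 0 *\<^sub>R b))"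
    by (auto simp: inner_diff_right)
  have s01: "s \<in> {0..1}" using s(1) by auto
  have d2: "((\<lambda>t. a \<bullet> g (x + s *\<^sub>R a + t *\<^sub>R b)) has_derivative
      (\<lambda>h. a \<bullet> H (x + s *\<^sub>R a + t *\<^sub>R b) (h *\<^sub>R b))) (at t within {0..1})"
    if "t \<in> {0..1}" for t
  proof (rule has_derivative_inner_right, rule has_derivative_compose[where g = g
        and g' = "H (x + s *\<^sub>R a + t *\<^sub>R b)" and f' = "\<lambda>h. h *\<^sub>R b"])
    show "(g has_derivative H (x + s *\<^sub>R a + t *\<^sub>R b)) (at (x + s *\<^sub>R a + t *\<^sub>R b))"
      using s01 that by (intro g in_ball)
  qed (auto intro!: derivative_eq_intros)
  have "\<exists>t\<in>{0<..<1}. (\<lambda>t. a \<bullet> g (x + s *\<^sub>R a + t *\<^sub>R b)) 1 - (\<lambda>t. a \<bullet> g (x + s *\<^sub>R a + t *\<^sub>R b)) 0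
      = (\<lambda>h. a \<bullet> H (x + s *\<^sub>R a + t *\<^sub>R b) (h *\<^sub>R b)) (1 - 0)"
    using d2 by (intro mvt_simple) auto
  then obtain t where t: "t \<in> {0<..<1}"
    "a \<bullet> (g (x + s *\<^sub>R a + 1 *\<^sub>R b) - g (x + s *\<^sub>R a + 0 *\<^sub>R b)) = a \<bullet> H (x + s *\<^sub>R a + t *\<^sub>R b) b"
    by (auto simp: inner_diff_right)
  have "f (x + a + b) - f (x + a) - f (x + b) + f x = a \<bullet> H (x + s *\<^sub>R a + t *\<^sub>R b) b"
    using s(2) t(2) by (simp add: \<psi>_def)
  moreover have "x + s *\<^sub>R a + t *\<^sub>R b \<in> ball x r"
    using s(1) t(1) by (intro in_ball) auto
  ultimately show thesis using that by blast
qed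

text \<open>
  The second difference with increments \<open>t a\<close> and \<open>t b\<close> is \<open>t\<^sup>2\<close> times a value of \<open>a \<bullet> H z b\<close>, and
  also \<open>t\<^sup>2\<close> times a value of \<open>b \<bullet> H z' a\<close>, with \<open>z\<close> and \<open>z'\<close> close to \<open>x\<close>.  By continuity of the
  second derivative these two values converge to those at \<open>x\<close>.
\<close>

lemma second_derivative_symmetric:
  fixes f :: "'a::real_inner \<Rightarrow> real"
  assumes U: "open U" "x \<in> U"
    and f: "\<And>z. z \<in> U \<Longrightarrow> (f has_derivative (\<lambda>h. h \<bullet> g z)) (at z)"
    and g: "\<And>z. z \<in> U \<Longrightarrow> (g has_derivative H z) (at z)"
    and H: "\<And>h. continuous_on U (\<lambda>z. H z h)"
  shows "a \<bullet> H x b = b \<bullet> H x a"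
proof (rule ccontr)
  assume ne: "a \<bullet> H x b \<noteq> b \<bullet> H x a"
  define e where "e = \<bar>a \<bullet> H x b - b \<bullet> H x a\<bar> / 2"
  have e: "0 < e" using ne by (simp add: e_def)
  have "isCont (\<lambda>z. c \<bullet> H z d) x" for c d
    using H U by (auto intro!: continuous_intros simp: continuous_on_eq_continuous_at)
  then have "((\<lambda>z. c \<bullet> H z d) \<longlongrightarrow> c \<bullet> H x d) (nhds x)" for c d
    unfolding isCont_def using tendsto_at_iff_tendsto_nhds[of "\<lambda>z. c \<bullet> H z d" x] by blast
  from tendstoD[OF this e] have "\<forall>\<^sub>F z in nhds x. \<bar>a \<bullet> H z b - a \<bullet> H x b\<bar> < e"
    "\<forall>\<^sub>F z in nhds x. \<bar>b \<bullet> H z a - b \<bullet> H x a\<bar> < e"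
    by (simp_all add: dist_real_def)
  then have "\<forall>\<^sub>F z in nhds x. z \<in> U \<and> \<bar>a \<bullet> H z b - a \<bullet> H x b\<bar> < e \<and> \<bar>b \<bullet> H z a - b \<bullet> H x a\<bar> < e"
    using eventually_nhds_in_open[OF U] by eventually_elim auto
  then obtain r where r: "r > 0" "\<And>z. z \<in> ball x r \<Longrightarrow>
      z \<in> U \<and> \<bar>a \<bullet> H z b - a \<bullet> H x b\<bar> < e \<and> \<bar>b \<bullet> H z a - b \<bullet> H x a\<bar> < e"
    by (auto simp: eventually_nhds_metric dist_commute)
  define t where "t = r / (2 * (1 + norm a + norm b))"
  have pos: "1 + norm a + norm b > 0" by (smt (verit) norm_ge_zero)
  have t: "t > 0" using r(1) pos by (simp add: t_def)
  have small: "norm (t *\<^sub>R a) + norm (t *\<^sub>R b) < r"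
  proof -
    have "t * (norm a + norm b) < t * (2 * (1 + norm a + norm b))"
      using t by (intro mult_strict_left_mono) (smt (verit) norm_ge_zero)+
    also have "\<dots> = r" using pos by (simp add: t_def)
    finally show ?thesis using t by (simp add: distrib_left)
  qed
  have lin: "linear (H z)" if "z \<in> ball x r" for z
    using g r(2)[OF that] has_derivative_linear by blast
  have f': "(f has_derivative (\<lambda>h. h \<bullet> g z)) (at z)"
    and g': "(g has_derivative H z) (at z)" if "z \<in> ball x r" for z
    using r(2)[OF that] f g by blast+
  obtain z where z: "z \<in> ball x r"
    "f (x + t *\<^sub>R a + t *\<^sub>R b) - f (x + t *\<^sub>R a) - f (x + t *\<^sub>R b) + f x = t *\<^sub>R a \<bullet> H z (t *\<^sub>R b)"
    using second_difference_mean_value[OF f' g' small] .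
  obtain y where y: "y \<in> ball x r"
    "f (x + t *\<^sub>R b + t *\<^sub>R a) - f (x + t *\<^sub>R b) - f (x + t *\<^sub>R a) + f x = t *\<^sub>R b \<bullet> H y (t *\<^sub>R a)"
    using second_difference_mean_value[OF f' g' small[unfolded add.commute[of "norm (t *\<^sub>R a)"]]] .
  have "t *\<^sub>R a \<bullet> H z (t *\<^sub>R b) = t *\<^sub>R b \<bullet> H y (t *\<^sub>R a)"
    using z(2) y(2) by (simp only: add.assoc add.commute[of "t *\<^sub>R b"])
  then have "a \<bullet> H z b = b \<bullet> H y a"
    using t by (simp add: linear_cmul[OF lin[OF z(1)]] linear_cmul[OF lin[OF y(1)]])
  then show False
    using r(2)[OF z(1)] r(2)[OF y(1)] unfolding e_def by (smt (verit) field_sum_of_halves)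
qed

lemma hessian_symmetric:
  fixes f :: "real^'n \<Rightarrow> real"
  assumes "open U" "C2_on U f" "x \<in> U"
  shows "hessian f x \<in> sym_matrices"
proof -
  have "a \<bullet> (hessian f x *v b) = b \<bullet> (hessian f x *v a)" for a b
    by (rule second_derivative_symmetric[where f = f and g = "grad f" and H = "\<lambda>z h. hessian f z *v h"])
       (use assms in \<open>auto simp: C2_on_def matrix_vector_mult_def
          intro!: has_derivative_grad has_derivative_hessian[unfolded matrix_vector_mult_def]
            continuous_intros\<close>)
  from this[of "axis _ 1" "axis _ 1"] show ?thesis
    by (simp add: sym_matrices_def vec_eq_iff transpose_def inner_axis' matrix_vector_mul_component
        inner_axis)
qed

section \<open>The exponential barrier\<close>

definition outer :: "real^'n \<Rightarrow> real^'n^'n"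
  where "outer \<xi> = (\<chi> i j. \<xi> $ i * \<xi> $ j)"

lemma outer_mult_vec: "outer \<xi> *v h = (\<xi> \<bullet> h) *\<^sub>R \<xi>"
  by (simp add: outer_def matrix_vector_mult_def inner_vec_def vec_eq_iff sum_distrib_left mult_ac)

lemma inner_outer: "A \<bullet> outer \<xi> = (\<Sum>i\<in>UNIV. \<Sum>j\<in>UNIV. A $ i $ j * \<xi> $ i * \<xi> $ j)"
  by (simp add: outer_def inner_vec_def mult_ac)

lemma outer_sym: "outer \<xi> \<in> sym_matrices"
  by (simp add: outer_def sym_matrices_def transpose_def vec_eq_iff mult_ac)

lemma sym_matrices_add_scaleR:
  "M \<in> sym_matrices \<Longrightarrow> N \<in> sym_matrices \<Longrightarrow> M + c *\<^sub>R N \<in> sym_matrices"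
  by (simp add: sym_matrices_def transpose_def vec_eq_iff)

lemma closed_sym_matrices: "closed (sym_matrices :: (real^'n^'n) set)"
proof -
  have "(sym_matrices :: (real^'n^'n) set) = (\<Inter>i. \<Inter>j. {M :: real^'n^'n. M $ i $ j = M $ j $ i})"
    by (auto simp: sym_matrices_def transpose_def vec_eq_iff)
  also have "closed \<dots>"
    by (intro closed_INT ballI closed_Collect_eq continuous_intros)
  finally show ?thesis .
qed

lemma C2_on_add_barrier:
  fixes v :: "real^'n \<Rightarrow> real" and \<xi> :: "real^'n" and \<alpha> \<epsilon> c :: real
  defines "h \<equiv> \<lambda>x. exp (\<alpha> * (\<xi> \<bullet> x))"
  defines "\<phi> \<equiv> \<lambda>x. v x + \<epsilon> * h x + c"
  assumes U: "open U" and v: "C2_on U v"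
  shows "C2_on U \<phi>"
    and "\<And>x. x \<in> U \<Longrightarrow> grad \<phi> x = grad v x + (\<epsilon> * \<alpha> * h x) *\<^sub>R \<xi>"
    and "\<And>x. x \<in> U \<Longrightarrow> hessian \<phi> x = hessian v x + (\<epsilon> * \<alpha>\<^sup>2 * h x) *\<^sub>R outer \<xi>"
proof -
  have 1: "(\<phi> has_derivative (\<lambda>k. k \<bullet> (grad v z + (\<epsilon> * \<alpha> * h z) *\<^sub>R \<xi>))) (at z)" if "z \<in> U" for z
    unfolding \<phi>_def h_def
    by (rule derivative_eq_intros has_derivative_grad | use that v in \<open>force simp: C2_on_def\<close>
        | simp add: fun_eq_iff inner_add_right inner_commute algebra_simps)+
  have 2: "((\<lambda>z. grad v z + (\<epsilon> * \<alpha> * h z) *\<^sub>R \<xi>) has_derivative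
      (\<lambda>k. (hessian v z + (\<epsilon> * \<alpha>\<^sup>2 * h z) *\<^sub>R outer \<xi>) *v k)) (at z)" if "z \<in> U" for z
    unfolding h_def
    by (rule derivative_eq_intros has_derivative_hessian | use that v in \<open>force simp: C2_on_def\<close>
        | simp add: fun_eq_iff matrix_vector_mult_add_rdistrib scaleR_matrix_vector_assoc[symmetric]
           outer_mult_vec power2_eq_square algebra_simps)+
  have 3: "continuous_on U (\<lambda>z. hessian v z + (\<epsilon> * \<alpha>\<^sup>2 * h z) *\<^sub>R outer \<xi>)"
    using v unfolding h_def C2_on_def by (auto intro!: continuous_intros)
  note C2_onI[OF U 1 2 3]
  then show "C2_on U \<phi>"
    and "\<And>x. x \<in> U \<Longrightarrow> grad \<phi> x = grad v x + (\<epsilon> * \<alpha> * h x) *\<^sub>R \<xi>"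
    and "\<And>x. x \<in> U \<Longrightarrow> hessian \<phi> x = hessian v x + (\<epsilon> * \<alpha>\<^sup>2 * h x) *\<^sub>R outer \<xi>"
    by blast+
qed

section \<open>The variation of the operator\<close>

lemma operator_antimono_s:
  assumes C1: "C1_in_spM \<Omega> F Fs Fp FM" and x: "x \<in> \<Omega>" and M: "M \<in> sym_matrices"
    and Fs: "\<And>s. Fs x s p M \<le> 0" and st: "s \<le> t"
  shows "F x t p M \<le> F x s p M"
proof (rule DERIV_nonpos_imp_nonincreasing[OF st, where f = "\<lambda>r. F x r p M"])
  fix r
  have "((\<lambda>t. F x t p M) has_real_derivative Fs x r p M) (at r)"
    using C1 x M by (simp add: C1_in_spM_def)
  then show "\<exists>y. ((\<lambda>t. F x t p M) has_real_derivative y) (at r) \<and> y \<le> 0"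
    using Fs by blast
qed

text \<open>
  The hypotheses speak of partial derivatives, so the increment is split into a step in \<open>M\<close> and a
  step in \<open>p\<close>, each treated by the mean value theorem in one variable.
\<close>

lemma operator_increment_mean_value:
  assumes C1: "C1_in_spM \<Omega> F Fs Fp FM" and x: "x \<in> \<Omega>"
    and M: "M \<in> sym_matrices" and N: "N \<in> sym_matrices"
  obtains t r where "t \<in> {0..1}" "r \<in> {0..1}"
    "F x s (p + q) (M + N) - F x s p M
      = FM x s (p + q) (M + t *\<^sub>R N) \<bullet> N + q \<bullet> Fp x s (p + r *\<^sub>R q) M"
proof -
  have dp: "((\<lambda>r. F x s (p + r *\<^sub>R q) M) has_derivative (\<lambda>h. (h *\<^sub>R q) \<bullet> Fp x s (p + r *\<^sub>R q) M))
      (at r within {0..1})" for r :: real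
  proof (rule has_derivative_compose[where g = "\<lambda>y. F x s y M"])
    show "((\<lambda>y. F x s y M) has_derivative (\<lambda>h. h \<bullet> Fp x s (p + r *\<^sub>R q) M)) (at (p + r *\<^sub>R q))"
      using C1 x M by (simp add: C1_in_spM_def gderiv_def)
  qed (auto intro!: derivative_eq_intros)
  have dM: "((\<lambda>t. F x s (p + q) (M + t *\<^sub>R N)) has_derivative
      (\<lambda>h. FM x s (p + q) (M + t *\<^sub>R N) \<bullet> (h *\<^sub>R N))) (at t within {0..1})"
    if "t \<in> {0..1}" for t :: real
  proof (rule has_derivative_in_compose2[where g = "\<lambda>N. F x s (p + q) N" and t = sym_matrices])
    show "((\<lambda>N. F x s (p + q) N) has_derivative (\<lambda>H. FM x s (p + q) B \<bullet> H))
        (at B within sym_matrices)" if "B \<in> sym_matrices" for B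
      using C1 x that by (simp add: C1_in_spM_def)
  qed (use M N that in \<open>auto intro!: derivative_eq_intros sym_matrices_add_scaleR\<close>)
  have "\<exists>r\<in>{0<..<1}. F x s (p + 1 *\<^sub>R q) M - F x s (p + 0 *\<^sub>R q) M
      = (\<lambda>h. (h *\<^sub>R q) \<bullet> Fp x s (p + r *\<^sub>R q) M) (1 - 0)"
    by (rule mvt_simple) (use dp in auto)
  moreover have "\<exists>t\<in>{0<..<1}. F x s (p + q) (M + 1 *\<^sub>R N) - F x s (p + q) (M + 0 *\<^sub>R N)
      = (\<lambda>h. FM x s (p + q) (M + t *\<^sub>R N) \<bullet> (h *\<^sub>R N)) (1 - 0)"
    by (rule mvt_simple) (use dM in auto)
  ultimately obtain r t where "r \<in> {0<..<1}" "t \<in> {0<..<1}"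
    "F x s (p + q) M - F x s p M = q \<bullet> Fp x s (p + r *\<^sub>R q) M"
    "F x s (p + q) (M + N) - F x s (p + q) M = FM x s (p + q) (M + t *\<^sub>R N) \<bullet> N"
    by auto
  then show thesis by (intro that[of t r]) auto
qed

text \<open>
  Pointwise positivity in the direction \<open>\<xi>\<close> becomes uniform because the arguments considered here
  range over a compact set.
\<close>

lemma uniform_bounds_near_jet:
  fixes v :: "real^'n \<Rightarrow> real"
  assumes C1: "C1_in_spM \<Omega> F Fs Fp FM"
    and pos: "\<And>x s p M. x \<in> \<Omega> \<Longrightarrow> M \<in> sym_matrices \<Longrightarrow> 0 < FM x s p M \<bullet> outer \<xi>"
    and v: "C2_on \<Omega> v" and \<Omega>: "open \<Omega>" and K: "compact K" "K \<subseteq> \<Omega>"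
  obtains l L where "0 < l" "0 \<le> L"
    "\<And>x p M. x \<in> K \<Longrightarrow> M \<in> sym_matrices \<Longrightarrow> norm (p - grad v x) \<le> 1 \<Longrightarrow>
       norm (M - hessian v x) \<le> 1 \<Longrightarrow>
       l \<le> FM x (v x) p M \<bullet> outer \<xi> \<and> norm (Fp x (v x) p M) \<le> L"
proof (cases "K = {}")
  case True
  show thesis by (rule that[of 1 0]) (use True in auto)
next
  case False
  have "continuous_on \<Omega> v" "continuous_on \<Omega> (grad v)" "continuous_on \<Omega> (hessian v)"
    using v unfolding C2_on_def
    by (blast intro: continuous_at_imp_continuous_on differentiable_imp_continuous_within)+
  then have cont: "continuous_on K v" "continuous_on K (grad v)" "continuous_on K (hessian v)"
    using K(2) by (blast intro: continuous_on_subset)+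
  define P where "P = {y + w |y w. y \<in> grad v ` K \<and> w \<in> cball 0 1}"
  define Q where "Q = {y + w |y w. y \<in> hessian v ` K \<and> w \<in> cball 0 1} \<inter> sym_matrices"
  define C where "C = K \<times> v ` K \<times> P \<times> Q"
  have C: "compact C"
    unfolding C_def P_def Q_def
    by (intro compact_Times compact_Int_closed compact_sums compact_continuous_image K cont
        compact_cball closed_sym_matrices)
  have C_sub: "C \<subseteq> \<Omega> \<times> UNIV \<times> UNIV \<times> sym_matrices"
    using K by (auto simp: C_def Q_def)
  have C_mem: "(x, v x, p, M) \<in> C" if "x \<in> K" "M \<in> sym_matrices" "norm (p - grad v x) \<le> 1"
    "norm (M - hessian v x) \<le> 1" for x p M
  proof -
    have "p = grad v x + (p - grad v x)" "M = hessian v x + (M - hessian v x)" by auto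
    with that have "p \<in> P" "M \<in> Q"
      unfolding P_def Q_def by (auto simp del: add_diff_cancel_left' intro!: exI)
    with that show ?thesis
      by (simp add: C_def)
  qed
  have "C \<noteq> {}"
  proof -
    obtain x where "x \<in> K" using False by blast
    then have "(x, v x, grad v x, hessian v x) \<in> C"
      using hessian_symmetric[OF \<Omega> v] K(2) by (intro C_mem) auto
    then show ?thesis by blast
  qed
  moreover have "continuous_on C (\<lambda>(x, s, p, M). FM x s p M \<bullet> outer \<xi>)"
  proof -
    have "continuous_on C (\<lambda>(x, s, p, M). FM x s p M)"
      using C1 C_sub unfolding C1_in_spM_def by (blast intro: continuous_on_subset)
    then have "continuous_on C (\<lambda>y. (case y of (x, s, p, M) \<Rightarrow> FM x s p M) \<bullet> outer \<xi>)"
      by (intro continuous_intros)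
    then show ?thesis by (simp add: case_prod_unfold)
  qed
  ultimately obtain y where y: "y \<in> C" "\<And>z. z \<in> C \<Longrightarrow>
      (\<lambda>(x, s, p, M). FM x s p M \<bullet> outer \<xi>) y \<le> (\<lambda>(x, s, p, M). FM x s p M \<bullet> outer \<xi>) z"
    using continuous_attains_inf[OF C] by blast
  define l where "l = (\<lambda>(x, s, p, M). FM x s p M \<bullet> outer \<xi>) y"
  have "0 < l"
    using y(1) C_sub pos by (auto simp: l_def)
  have "continuous_on C (\<lambda>(x, s, p, M). Fp x s p M)"
    using C1 C_sub unfolding C1_in_spM_def by (blast intro: continuous_on_subset)
  then have "bounded ((\<lambda>(x, s, p, M). Fp x s p M) ` C)"
    using C by (intro compact_imp_bounded compact_continuous_image)
  then obtain L where "0 < L" and L: "\<And>z. z \<in> C \<Longrightarrow> norm ((\<lambda>(x, s, p, M). Fp x s p M) z) \<le> L"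
    unfolding bounded_pos by blast
  show thesis
  proof (rule that[of l L])
    show "l \<le> FM x (v x) p M \<bullet> outer \<xi> \<and> norm (Fp x (v x) p M) \<le> L"
      if "x \<in> K" "M \<in> sym_matrices" "norm (p - grad v x) \<le> 1" "norm (M - hessian v x) \<le> 1" for x p M
      using y(2)[OF C_mem[OF that]] L[OF C_mem[OF that]] by (simp add: l_def)
  qed (use \<open>0 < l\<close> \<open>0 < L\<close> in auto)
qed

section \<open>The comparison principle\<close>

theorem theorem2p1:
  fixes \<Omega> :: "(real^'n) set"
    and F Fs :: "real^'n \<Rightarrow> real \<Rightarrow> real^'n \<Rightarrow> real^'n^'n \<Rightarrow> real"
    and Fp :: "real^'n \<Rightarrow> real \<Rightarrow> real^'n \<Rightarrow> real^'n^'n \<Rightarrow> real^'n"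
    and FM :: "real^'n \<Rightarrow> real \<Rightarrow> real^'n \<Rightarrow> real^'n^'n \<Rightarrow> real^'n^'n"
    and \<xi> :: "real^'n"
    and u v :: "real^'n \<Rightarrow> real"
  assumes "open \<Omega>" and "bounded \<Omega>"
    and "C1_in_spM \<Omega> F Fs Fp FM"
    and "\<forall>x\<in>\<Omega>. \<forall>s p. \<forall>M\<in>sym_matrices. pos_semidef (FM x s p M)"
    and "norm \<xi> = 1"
    and "\<forall>x\<in>\<Omega>. \<forall>s p. \<forall>M\<in>sym_matrices. 0 < (\<Sum>i\<in>UNIV. \<Sum>j\<in>UNIV. FM x s p M $ i $ j * \<xi> $ i * \<xi> $ j)"
    and "lsc_on (closure \<Omega>) u"
    and "C2_on \<Omega> v" and "continuous_on (closure \<Omega>) v"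
    and "viscosity_le \<Omega> F u v"
    and "\<forall>x\<in>frontier \<Omega>. u x \<ge> v x"
    and "bdd_below (u ` \<Omega>)"
    and "\<forall>x\<in>\<Omega>. \<forall>s p. \<forall>M\<in>sym_matrices. Fs x s p M \<le> 0"
  shows "\<forall>x\<in>\<Omega>. u x \<ge> v x"
proof (rule ccontr)
  assume "\<not> ?thesis"
  then obtain x1 where x1: "x1 \<in> \<Omega>" "u x1 < v x1" by (auto simp: not_le)
  note \<Omega> = assms(1) and C1 = assms(3) and v = assms(8)
  have sym_v: "hessian v x \<in> sym_matrices" if "x \<in> \<Omega>" for x
    using hessian_symmetric[OF \<Omega> v that] .
  have cl: "compact (closure \<Omega>)" using assms(2) by (simp add: compact_closure)
  have x1_cl: "x1 \<in> closure \<Omega>" using x1(1) closure_subset by blast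

  define m where "m = v x1 - u x1"
  have m: "0 < m" using x1 by (simp add: m_def)
  define K where "K = {x \<in> closure \<Omega>. u x - v x \<le> - (m / 2)}"
  have "compact K"
    using closedin_compact[OF cl lsc_on_closedin_sublevel[OF lsc_on_diff_continuous[OF assms(7,9)]]]
    by (simp add: K_def)
  have "K \<subseteq> \<Omega>"
  proof
    fix x assume x: "x \<in> K"
    then have "x \<notin> frontier \<Omega>" using assms(11) m by (force simp: K_def)
    with x show "x \<in> \<Omega>"
      using \<Omega> by (auto simp: K_def frontier_def interior_open)
  qed

  have pos: "0 < FM x s p M \<bullet> outer \<xi>" if "x \<in> \<Omega>" "M \<in> sym_matrices" for x s p M
    using assms(6) that by (simp add: inner_outer)
  obtain l L where l: "0 < l" and L: "0 \<le> L"
    and bounds: "\<And>x p M. x \<in> K \<Longrightarrow> M \<in> sym_matrices \<Longrightarrow> norm (p - grad v x) \<le> 1 \<Longrightarrow>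
       norm (M - hessian v x) \<le> 1 \<Longrightarrow>
       l \<le> FM x (v x) p M \<bullet> outer \<xi> \<and> norm (Fp x (v x) p M) \<le> L"
    using uniform_bounds_near_jet[OF C1 pos v \<Omega> \<open>compact K\<close> \<open>K \<subseteq> \<Omega>\<close>] by blast

  define \<alpha> where "\<alpha> = L / l + 1"
  have \<alpha>: "0 < \<alpha>" "L < \<alpha> * l"
    using l L by (auto simp: \<alpha>_def field_simps add_nonneg_pos)
  define h where "h x = exp (\<alpha> * (\<xi> \<bullet> x))" for x
  have h_pos: "0 < h x" for x by (simp add: h_def)
  have h_cont: "continuous_on S h" for S unfolding h_def by (intro continuous_intros)
  obtain B where B: "0 < B" "\<And>x. x \<in> closure \<Omega> \<Longrightarrow> h x \<le> B"
  proof -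
    have "bounded (h ` closure \<Omega>)"
      using cl h_cont by (intro compact_imp_bounded compact_continuous_image)
    then show thesis using that by (fastforce simp: bounded_pos)
  qed

  \<comment> \<open>The first term of the denominator and \<open>m / 2\<close> keep the minimum point inside \<open>K\<close>; the other two
    keep the perturbed gradient and Hessian within distance one of those of \<open>v\<close>.\<close>
  define D where "D = 1 + \<alpha> + \<alpha>\<^sup>2 * norm (outer \<xi>)"
  define \<epsilon> where "\<epsilon> = min (m / 2) 1 / (B * D)"
  have D: "1 \<le> D" "\<alpha> \<le> D" "\<alpha>\<^sup>2 * norm (outer \<xi>) \<le> D"
    using \<alpha> by (auto simp: D_def add_nonneg_nonneg)
  have \<epsilon>: "0 < \<epsilon>" using m B D by (simp add: \<epsilon>_def)
  have \<epsilon>_le: "\<epsilon> * k * h x \<le> min (m / 2) 1" if "0 \<le> k" "k \<le> D" "x \<in> closure \<Omega>" for k x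
  proof -
    have "\<epsilon> * k * h x \<le> \<epsilon> * D * B"
      using that \<epsilon> B(2) h_pos D by (intro mult_mono) (auto intro: less_imp_le)
    also have "\<dots> = min (m / 2) 1" using B D by (simp add: \<epsilon>_def)
    finally show ?thesis .
  qed

  have "lsc_on (closure \<Omega>) (\<lambda>x. u x - (v x + \<epsilon> * h x))"
    using assms(7,9) h_cont by (intro lsc_on_diff_continuous continuous_intros)
  from lsc_on_attains_min[OF this cl] obtain x0 where x0_cl: "x0 \<in> closure \<Omega>"
    and x0_min: "\<And>y. y \<in> closure \<Omega> \<Longrightarrow> u x0 - (v x0 + \<epsilon> * h x0) \<le> u y - (v y + \<epsilon> * h y)"
    using x1_cl by (metis emptyE)
  have "u x0 - v x0 \<le> - m + \<epsilon> * h x0"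
    using x0_min[OF x1_cl] mult_pos_pos[OF \<epsilon> h_pos[of x1]] unfolding m_def by linarith
  also have "\<dots> \<le> - (m / 2)"
    using \<epsilon>_le[of 1 x0] D x0_cl by simp
  finally have x0_less: "u x0 - v x0 \<le> - (m / 2)" .
  then have x0K: "x0 \<in> K" using x0_cl by (simp add: K_def)
  then have x0: "x0 \<in> \<Omega>" using \<open>K \<subseteq> \<Omega>\<close> by blast

  define c where "c = u x0 - (v x0 + \<epsilon> * h x0)"
  define \<phi> where "\<phi> x = v x + \<epsilon> * h x + c" for x
  define b where "b = \<epsilon> * \<alpha> * h x0"
  define q where "q = b *\<^sub>R \<xi>"
  define N where "N = (b * \<alpha>) *\<^sub>R outer \<xi>"
  have b: "0 < b" using \<epsilon> \<alpha> h_pos by (simp add: b_def)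
  note barrier = C2_on_add_barrier[OF \<Omega> v, where \<alpha> = \<alpha> and \<xi> = \<xi> and \<epsilon> = \<epsilon> and c = c,
      folded h_def, folded \<phi>_def]
  have \<phi>_grad: "grad \<phi> x0 = grad v x0 + q"
    and \<phi>_hess: "hessian \<phi> x0 = hessian v x0 + N"
    using barrier(2,3)[OF x0] by (simp_all add: q_def N_def b_def power2_eq_square mult_ac)
  have "\<forall>\<^sub>F y in nhds x0. \<phi> y \<le> u y"
    using eventually_nhds_in_open[OF \<Omega> x0]
  proof eventually_elim
    case (elim y)
    then have "y \<in> closure \<Omega>" using closure_subset by blast
    from x0_min[OF this] show ?case by (simp add: \<phi>_def c_def)
  qed
  moreover have \<phi>_x0: "\<phi> x0 = u x0" by (simp add: \<phi>_def c_def)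
  ultimately have "F x0 (\<phi> x0) (grad \<phi> x0) (hessian \<phi> x0) \<le> F x0 (v x0) (grad v x0) (hessian v x0)"
    using assms(10) \<Omega> x0 barrier(1) unfolding viscosity_le_def by blast
  then have touch: "F x0 (u x0) (grad v x0 + q) (hessian v x0 + N)
      \<le> F x0 (v x0) (grad v x0) (hessian v x0)"
    by (simp only: \<phi>_x0 \<phi>_grad \<phi>_hess)

  have N_sym: "N \<in> sym_matrices"
    using outer_sym[of \<xi>]
    by (simp add: N_def sym_matrices_def transpose_def vec_eq_iff)
  have sym: "hessian v x0 + t *\<^sub>R N \<in> sym_matrices" for t
    using sym_v[OF x0] N_sym by (rule sym_matrices_add_scaleR)
  have q_le: "norm q \<le> 1"
    using \<epsilon>_le[of \<alpha> x0] D \<alpha> x0_cl b assms(5) by (simp add: q_def b_def)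
  have N_le: "norm N \<le> 1"
    using \<epsilon>_le[of "\<alpha>\<^sup>2 * norm (outer \<xi>)" x0] D \<alpha> x0_cl b \<epsilon> h_pos[of x0]
    by (simp add: N_def b_def power2_eq_square mult_ac abs_mult)
  have "F x0 (v x0) (grad v x0 + q) (hessian v x0 + N)
      \<le> F x0 (u x0) (grad v x0 + q) (hessian v x0 + N)"
    using assms(13) x0 sym[of 1] x0_less m by (intro operator_antimono_s[OF C1]) auto
  with touch have le: "F x0 (v x0) (grad v x0 + q) (hessian v x0 + N)
      - F x0 (v x0) (grad v x0) (hessian v x0) \<le> 0"
    by simp
  obtain t r where tr: "t \<in> {0..1}" "r \<in> {0..1}"
    and inc: "F x0 (v x0) (grad v x0 + q) (hessian v x0 + N) - F x0 (v x0) (grad v x0) (hessian v x0)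
      = FM x0 (v x0) (grad v x0 + q) (hessian v x0 + t *\<^sub>R N) \<bullet> N
        + q \<bullet> Fp x0 (v x0) (grad v x0 + r *\<^sub>R q) (hessian v x0)"
    using operator_increment_mean_value[OF C1 x0 sym_v[OF x0] N_sym] .
  have "norm (t *\<^sub>R N) \<le> 1" "norm (r *\<^sub>R q) \<le> 1"
    using tr q_le N_le by (auto intro!: mult_le_one)
  then have FM_ge: "l \<le> FM x0 (v x0) (grad v x0 + q) (hessian v x0 + t *\<^sub>R N) \<bullet> outer \<xi>"
    and Fp_le: "norm (Fp x0 (v x0) (grad v x0 + r *\<^sub>R q) (hessian v x0)) \<le> L"
    using bounds[OF x0K sym, of "grad v x0 + q" t] bounds[OF x0K sym_v[OF x0], of "grad v x0 + r *\<^sub>R q"]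
      q_le by auto
  have "b * (\<alpha> * l) \<le> FM x0 (v x0) (grad v x0 + q) (hessian v x0 + t *\<^sub>R N) \<bullet> N"
    using FM_ge b \<alpha>(1) by (simp add: N_def mult.assoc)
  moreover have "- (b * L) \<le> q \<bullet> Fp x0 (v x0) (grad v x0 + r *\<^sub>R q) (hessian v x0)"
  proof -
    have "\<bar>q \<bullet> Fp x0 (v x0) (grad v x0 + r *\<^sub>R q) (hessian v x0)\<bar>
        \<le> norm q * norm (Fp x0 (v x0) (grad v x0 + r *\<^sub>R q) (hessian v x0))"
      by (rule Cauchy_Schwarz_ineq2)
    also have "\<dots> \<le> b * L"
      using Fp_le b assms(5) by (simp add: q_def)
    finally show ?thesis by linarith
  qed
  moreover have "b * L < b * (\<alpha> * l)" using b \<alpha>(2) by simp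
  ultimately show False using le inc by linarith
qed

end
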